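(* The Cartan canonical connection $C\mathring\Gamma$ of the rheonomic Berwald-Moór metric $\mathring F(t,y)=\sqrt{h^{11}(t)}\,\sqrt[4]{y_1^1y_1^2y_1^3y_1^4}$ has three effective local curvature d-tensors, namely $$R_{ijk}^l=\frac19\varkappa_{11}^1\varkappa_{11}^1S_{i(j)(k)}^{l(1)(1)},\qquad P_{ij(k)}^{l\,(1)}=\frac13\varkappa_{11}^1S_{i(j)(k)}^{l(1)(1)},$$ $$S_{i(j)(k)}^{l(1)(1)}=\frac{\partial C_{i(j)}^{l(1)}}{\partial y_1^k}-\frac{\partial C_{i(k)}^{l(1)}}{\partial y_1^j}+C_{i(j)}^{m(1)}C_{m(k)}^{l(1)}-C_{i(k)}^{m(1)}C_{m(j)}^{l(1)};$$ the other two curvature d-tensors $R_{i1k}^l$ and $P_{i1(k)}^{l\,(1)}$ vanish identically.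
   Context: All indices $i,j,k,l,m,p,\dots$ run from $1$ to $4$; repeated indices are summed; $\delta$ with two indices is the Kronecker symbol. Let $h_{11}:\mathbb{R}\to(0,\infty)$ be a smooth function (a Riemannian metric on $\mathbb{R}$), $h^{11}=1/h_{11}$, and $\varkappa_{11}^1=\frac{h^{11}}{2}\frac{dh_{11}}{dt}$. Work in local coordinates $(t,x^i,y_1^i)$ of the $1$-jet space $J^1(\mathbb{R},M^4)$, $M^4$ a $4$-dimensional manifold, on the domain where $y_1^1y_1^2y_1^3y_1^4>0$. Put $g_{ij}=\frac{h_{11}}{2}\frac{\partial^2\mathring F^2}{\partial y_1^i\partial y_1^j}$, with inverse matrix $(g^{jk})$. The nonlinear connection used is $\mathring\Gamma=\left(M_{(1)1}^{(i)}=-\varkappa_{11}^1y_1^i,\ N_{(1)j}^{(i)}=-\frac{\varkappa_{11}^1}{3}\delta_j^i\right)$, with adapted vector fields $$\frac{\delta}{\delta t}=\frac{\partial}{\partial t}+\varkappa_{11}^1y_1^p\frac{\partial}{\partial y_1^p},\qquad \frac{\delta}{\delta x^i}=\frac{\partial}{\partial x^i}+\frac{\varkappa_{11}^1}{3}\frac{\partial}{\partial y_1^i},\qquad \frac{\partial}{\partial y_1^i}.$$ The Cartan canonical connection $C\mathring\Gamma=(\varkappa_{11}^1,G_{j1}^k,L_{jk}^i,C_{j(k)}^{i(1)})$ has adapted components $$G_{j1}^k=\frac{g^{km}}{2}\frac{\delta g_{mj}}{\delta t},\quad L_{jk}^i=\frac{g^{im}}{2}\left(\frac{\delta g_{jm}}{\delta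 x^k}+\frac{\delta g_{km}}{\delta x^j}-\frac{\delta g_{jk}}{\delta x^m}\right),\quad C_{j(k)}^{i(1)}=\frac{g^{im}}{2}\frac{\partial g_{jm}}{\partial y_1^k}.$$ It is the linear connection $\nabla$ on the domain given, in the adapted basis, by $$\nabla_{\delta/\delta t}\frac{\delta}{\delta t}=\varkappa_{11}^1\frac{\delta}{\delta t},\quad \nabla_{\delta/\delta t}\frac{\delta}{\delta x^i}=G_{i1}^k\frac{\delta}{\delta x^k},\quad \nabla_{\delta/\delta t}\frac{\partial}{\partial y_1^i}=\left(G_{i1}^k-\varkappa_{11}^1\delta_i^k\right)\frac{\partial}{\partial y_1^k},$$ $$\nabla_{\delta/\delta x^j}\frac{\delta}{\delta t}=0,\quad \nabla_{\delta/\delta x^j}\frac{\delta}{\delta x^i}=L_{ij}^k\frac{\delta}{\delta x^k},\quad \nabla_{\delta/\delta x^j}\frac{\partial}{\partial y_1^i}=L_{ij}^k\frac{\partial}{\partial y_1^k},$$ $$\nabla_{\partial/\partial y_1^j}\frac{\delta}{\delta t}=0,\quad \nabla_{\partial/\partial y_1^j}\frac{\delta}{\delta x^i}=C_{i(j)}^{k(1)}\frac{\delta}{\delta x^k},\quad \nabla_{\partial/\partial y_1^j}\frac{\partial}{\partial y_1^i}=C_{i(j)}^{k(1)}\frac{\partial}{\partial y_1^k}.$$ With the curvature $\mathbf{R}(X,Y)Z=\nabla_X\nabla_YZ-\nabla_Y\nabla_XZ-\nabla_{[X,Y]}Z$, the five curvature d-tensors are the adapted components defined by $$\mathbf{R}\left(\tfrac{\delta}{\delta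 x^k},\tfrac{\delta}{\delta t}\right)\tfrac{\delta}{\delta x^i}=R_{i1k}^l\tfrac{\delta}{\delta x^l},\qquad \mathbf{R}\left(\tfrac{\delta}{\delta x^k},\tfrac{\delta}{\delta x^j}\right)\tfrac{\delta}{\delta x^i}=R_{ijk}^l\tfrac{\delta}{\delta x^l},$$ $$\mathbf{R}\left(\tfrac{\partial}{\partial y_1^k},\tfrac{\delta}{\delta t}\right)\tfrac{\delta}{\delta x^i}=P_{i1(k)}^{l\,(1)}\tfrac{\delta}{\delta x^l},\qquad \mathbf{R}\left(\tfrac{\partial}{\partial y_1^k},\tfrac{\delta}{\delta x^j}\right)\tfrac{\delta}{\delta x^i}=P_{ij(k)}^{l\,(1)}\tfrac{\delta}{\delta x^l},$$ $$\mathbf{R}\left(\tfrac{\partial}{\partial y_1^k},\tfrac{\partial}{\partial y_1^j}\right)\tfrac{\delta}{\delta x^i}=S_{i(j)(k)}^{l(1)(1)}\tfrac{\delta}{\delta x^l}.$$ Explicitly, for the present connection, $$R_{ijk}^l=\frac{\delta L_{ij}^l}{\delta x^k}-\frac{\delta L_{ik}^l}{\delta x^j}+L_{ij}^mL_{mk}^l-L_{ik}^mL_{mj}^l,\qquad P_{ij(k)}^{l\,(1)}=\frac{\partial L_{ij}^l}{\partial y_1^k}-C_{i(k)|j}^{l(1)}+C_{i(m)}^{l(1)}P_{(1)j(k)}^{(m)\,(1)},$$ where $P_{(1)j(k)}^{(m)\,(1)}=\frac{\partial N_{(1)j}^{(m)}}{\partial y_1^k}-L_{kj}^m$ and $C_{i(k)|j}^{l(1)}=\frac{\delta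 C_{i(k)}^{l(1)}}{\delta x^j}+C_{i(k)}^{m(1)}L_{mj}^l-C_{m(k)}^{l(1)}L_{ij}^m-C_{i(m)}^{l(1)}L_{kj}^m$. *)

theory Defs
  imports "HOL-Analysis.Analysis"
begin

text \<open>
  Points of the chart of the 1-jet space are triples \<open>(t, x, y)\<close>. The tangent space at every point is
  identified with the same vector space by means of the natural basis
  \<open>\<partial>/\<partial>t, \<partial>/\<partial>x\<^sup>i, \<partial>/\<partial>y\<^sup>i\<close>, so that a vector field is a function from jets to jets. The indices
  \<open>1, \<dots>, 4\<close> are the elements of the type \<open>4\<close>, in which the numeral 4 denotes the same element as 0.
\<close>

type_synonym jet = "real \<times> (real^4) \<times> (real^4)"

definition smooth :: "(real \<Rightarrow> real) \<Rightarrow> bool" where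
  "smooth f \<longleftrightarrow> (\<forall>n t. (deriv ^^ n) f differentiable (at t))"

text \<open>\<open>U\<close> is the image of the chart of the 4-manifold.\<close>

definition jet_domain :: "(real^4) set \<Rightarrow> jet set" where
  "jet_domain U = {(t, x, y). x \<in> U \<and> 0 < y $ 1 * y $ 2 * y $ 3 * y $ 4}"

definition deriv_along :: "(jet \<Rightarrow> jet) \<Rightarrow> (jet \<Rightarrow> 'b::real_normed_vector) \<Rightarrow> jet \<Rightarrow> 'b" where
  "deriv_along X f z = frechet_derivative f (at z) (X z)"

definition lie_bracket :: "(jet \<Rightarrow> jet) \<Rightarrow> (jet \<Rightarrow> jet) \<Rightarrow> jet \<Rightarrow> jet" where
  "lie_bracket X Y z = deriv_along X Y z - deriv_along Y X z"

definition kronecker :: "4 \<Rightarrow> 4 \<Rightarrow> real" where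
  "kronecker i j = (if i = j then 1 else 0)"

text \<open>In all that follows, \<open>h\<close> stands for \<open>h\<^sub>1\<^sub>1\<close> and \<open>1 / h\<close> for \<open>h\<^sup>1\<^sup>1\<close>.\<close>

definition kappa :: "(real \<Rightarrow> real) \<Rightarrow> real \<Rightarrow> real" where
  "kappa h t = (1 / h t) / 2 * deriv h t"

definition nonlinear_M :: "(real \<Rightarrow> real) \<Rightarrow> 4 \<Rightarrow> jet \<Rightarrow> real" where
  "nonlinear_M h i = (\<lambda>(t, x, y). - kappa h t * y $ i)"

definition nonlinear_N :: "(real \<Rightarrow> real) \<Rightarrow> 4 \<Rightarrow> 4 \<Rightarrow> jet \<Rightarrow> real" where
  "nonlinear_N h i j = (\<lambda>(t, x, y). - kappa h t / 3 * kronecker i j)"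

definition delta_t :: "(real \<Rightarrow> real) \<Rightarrow> jet \<Rightarrow> jet" where
  "delta_t h z = (1, 0, \<chi> p. - nonlinear_M h p z)"

definition delta_x :: "(real \<Rightarrow> real) \<Rightarrow> 4 \<Rightarrow> jet \<Rightarrow> jet" where
  "delta_x h i z = (0, axis i 1, \<chi> p. - nonlinear_N h p i z)"

definition partial_y :: "4 \<Rightarrow> jet \<Rightarrow> jet" where
  "partial_y i z = (0, 0, axis i 1)"

text \<open>
  The components of a tangent vector \<open>v\<close> at \<open>z\<close> with respect to the adapted basis; see
  \<open>adapted_expansion\<close> below.
\<close>

definition comp_t :: "jet \<Rightarrow> real" where
  "comp_t v = fst v"

definition comp_x :: "4 \<Rightarrow> jet \<Rightarrow> real" where
  "comp_x i v = fst (snd v) $ i"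

definition comp_y :: "(real \<Rightarrow> real) \<Rightarrow> jet \<Rightarrow> 4 \<Rightarrow> jet \<Rightarrow> real" where
  "comp_y h z i v =
     snd (snd v) $ i + nonlinear_M h i z * fst v + (\<Sum>j\<in>UNIV. nonlinear_N h i j z * fst (snd v) $ j)"

definition berwald_moor :: "(real \<Rightarrow> real) \<Rightarrow> jet \<Rightarrow> real" where
  "berwald_moor h = (\<lambda>(t, x, y). sqrt (1 / h t) * root 4 (y $ 1 * y $ 2 * y $ 3 * y $ 4))"

definition metric_g :: "(real \<Rightarrow> real) \<Rightarrow> 4 \<Rightarrow> 4 \<Rightarrow> jet \<Rightarrow> real" where
  "metric_g h i j z =
     h (fst z) / 2 * deriv_along (partial_y i) (deriv_along (partial_y j) (\<lambda>w. (berwald_moor h w)\<^sup>2)) z"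

definition metric_ginv :: "(real \<Rightarrow> real) \<Rightarrow> 4 \<Rightarrow> 4 \<Rightarrow> jet \<Rightarrow> real" where
  "metric_ginv h i j z = matrix_inv (\<chi> a b. metric_g h a b z) $ i $ j"

text \<open>
  In the coefficients of the Cartan connection the upper index is the first index argument and the
  lower ones follow in the order in which they are usually written: \<open>cartan_L h i j k\<close> is
  \<open>L\<^sup>i\<^sub>j\<^sub>k\<close>. The curvature components below follow the same rule.
\<close>

definition cartan_G :: "(real \<Rightarrow> real) \<Rightarrow> 4 \<Rightarrow> 4 \<Rightarrow> jet \<Rightarrow> real" where
  "cartan_G h k j z =
     (\<Sum>m\<in>UNIV. metric_ginv h k m z / 2 * deriv_along (delta_t h) (metric_g h m j) z)"

definition cartan_L :: "(real \<Rightarrow> real) \<Rightarrow> 4 \<Rightarrow> 4 \<Rightarrow> 4 \<Rightarrow> jet \<Rightarrow> real" where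
  "cartan_L h i j k z =
     (\<Sum>m\<in>UNIV. metric_ginv h i m z / 2 *
        (deriv_along (delta_x h k) (metric_g h j m) z + deriv_along (delta_x h j) (metric_g h k m) z
          - deriv_along (delta_x h m) (metric_g h j k) z))"

definition cartan_C :: "(real \<Rightarrow> real) \<Rightarrow> 4 \<Rightarrow> 4 \<Rightarrow> 4 \<Rightarrow> jet \<Rightarrow> real" where
  "cartan_C h i j k z =
     (\<Sum>m\<in>UNIV. metric_ginv h i m z / 2 * deriv_along (partial_y k) (metric_g h j m) z)"

text \<open>
  The Cartan connection, obtained by expanding both \<open>X\<close> and \<open>Y\<close> in the adapted basis and using
  linearity in \<open>X\<close> and the Leibniz rule in \<open>Y\<close>. Its values on the adapted basis are listed in
  \<open>nabla_adapted\<close>.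
\<close>

definition nabla_t :: "(real \<Rightarrow> real) \<Rightarrow> (jet \<Rightarrow> jet) \<Rightarrow> (jet \<Rightarrow> jet) \<Rightarrow> jet \<Rightarrow> real" where
  "nabla_t h X Y z =
     deriv_along X (\<lambda>w. comp_t (Y w)) z + comp_t (X z) * comp_t (Y z) * kappa h (fst z)"

definition nabla_x :: "(real \<Rightarrow> real) \<Rightarrow> (jet \<Rightarrow> jet) \<Rightarrow> (jet \<Rightarrow> jet) \<Rightarrow> 4 \<Rightarrow> jet \<Rightarrow> real" where
  "nabla_x h X Y k z =
     deriv_along X (\<lambda>w. comp_x k (Y w)) z
     + (\<Sum>i\<in>UNIV. comp_x i (Y z) *
         (comp_t (X z) * cartan_G h k i z
          + (\<Sum>j\<in>UNIV. comp_x j (X z) * cartan_L h k i j z)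
          + (\<Sum>j\<in>UNIV. comp_y h z j (X z) * cartan_C h k i j z)))"

definition nabla_y :: "(real \<Rightarrow> real) \<Rightarrow> (jet \<Rightarrow> jet) \<Rightarrow> (jet \<Rightarrow> jet) \<Rightarrow> 4 \<Rightarrow> jet \<Rightarrow> real" where
  "nabla_y h X Y k z =
     deriv_along X (\<lambda>w. comp_y h w k (Y w)) z
     + (\<Sum>i\<in>UNIV. comp_y h z i (Y z) *
         (comp_t (X z) * (cartan_G h k i z - kappa h (fst z) * kronecker i k)
          + (\<Sum>j\<in>UNIV. comp_x j (X z) * cartan_L h k i j z)
          + (\<Sum>j\<in>UNIV. comp_y h z j (X z) * cartan_C h k i j z)))"

definition nabla :: "(real \<Rightarrow> real) \<Rightarrow> (jet \<Rightarrow> jet) \<Rightarrow> (jet \<Rightarrow> jet) \<Rightarrow> jet \<Rightarrow> jet" where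
  "nabla h X Y z =
     nabla_t h X Y z *\<^sub>R delta_t h z
     + (\<Sum>k\<in>UNIV. nabla_x h X Y k z *\<^sub>R delta_x h k z)
     + (\<Sum>k\<in>UNIV. nabla_y h X Y k z *\<^sub>R partial_y k z)"

definition curvature ::
  "(real \<Rightarrow> real) \<Rightarrow> (jet \<Rightarrow> jet) \<Rightarrow> (jet \<Rightarrow> jet) \<Rightarrow> (jet \<Rightarrow> jet) \<Rightarrow> jet \<Rightarrow> jet" where
  "curvature h X Y Z z =
     nabla h X (nabla h Y Z) z - nabla h Y (nabla h X Z) z - nabla h (lie_bracket X Y) Z z"

text \<open>
  The five curvature d-tensors \<open>R\<^sup>l\<^sub>i\<^sub>1\<^sub>k\<close>, \<open>R\<^sup>l\<^sub>i\<^sub>j\<^sub>k\<close>, \<open>P\<^sup>l\<^sub>i\<^sub>1\<^sub>(\<^sub>k\<^sub>)\<close>, \<open>P\<^sup>l\<^sub>i\<^sub>j\<^sub>(\<^sub>k\<^sub>)\<close>,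
  \<open>S\<^sup>l\<^sub>i\<^sub>(\<^sub>j\<^sub>)\<^sub>(\<^sub>k\<^sub>)\<close>. They determine the curvature vectors by \<open>curvature_horizontal\<close>.
\<close>

definition curv_R1 :: "(real \<Rightarrow> real) \<Rightarrow> 4 \<Rightarrow> 4 \<Rightarrow> 4 \<Rightarrow> jet \<Rightarrow> real" where
  "curv_R1 h l i k z = comp_x l (curvature h (delta_x h k) (delta_t h) (delta_x h i) z)"

definition curv_R :: "(real \<Rightarrow> real) \<Rightarrow> 4 \<Rightarrow> 4 \<Rightarrow> 4 \<Rightarrow> 4 \<Rightarrow> jet \<Rightarrow> real" where
  "curv_R h l i j k z = comp_x l (curvature h (delta_x h k) (delta_x h j) (delta_x h i) z)"

definition curv_P1 :: "(real \<Rightarrow> real) \<Rightarrow> 4 \<Rightarrow> 4 \<Rightarrow> 4 \<Rightarrow> jet \<Rightarrow> real" where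
  "curv_P1 h l i k z = comp_x l (curvature h (partial_y k) (delta_t h) (delta_x h i) z)"

definition curv_P :: "(real \<Rightarrow> real) \<Rightarrow> 4 \<Rightarrow> 4 \<Rightarrow> 4 \<Rightarrow> 4 \<Rightarrow> jet \<Rightarrow> real" where
  "curv_P h l i j k z = comp_x l (curvature h (partial_y k) (delta_x h j) (delta_x h i) z)"

definition curv_S :: "(real \<Rightarrow> real) \<Rightarrow> 4 \<Rightarrow> 4 \<Rightarrow> 4 \<Rightarrow> 4 \<Rightarrow> jet \<Rightarrow> real" where
  "curv_S h l i j k z = comp_x l (curvature h (partial_y k) (partial_y j) (delta_x h i) z)"

lemma adapted_expansion:
  "v = comp_t v *\<^sub>R delta_t h z + (\<Sum>i\<in>UNIV. comp_x i v *\<^sub>R delta_x h i z)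
       + (\<Sum>i\<in>UNIV. comp_y h z i v *\<^sub>R partial_y i z)"
proof -
  have axis: "(\<Sum>i\<in>UNIV. axis i 1 $ k * c i) = c k" for c :: "4 \<Rightarrow> real" and k
    by (simp add: axis_def if_distrib[where f="\<lambda>a. a * _"] cong: if_cong)
  show ?thesis
    by (simp add: prod_eq_iff fst_sum snd_sum vec_eq_iff comp_t_def comp_x_def comp_y_def
        delta_t_def delta_x_def partial_y_def axis sum_negf mult.commute)
qed

lemma comp_adapted:
  "comp_t (delta_t h z) = 1" "comp_t (delta_x h i z) = 0" "comp_t (partial_y i z) = 0"
  "comp_x k (delta_t h z) = 0" "comp_x k (delta_x h i z) = kronecker i k" "comp_x k (partial_y i z) = 0"
  "comp_y h z k (delta_t h z) = 0" "comp_y h z k (delta_x h i z) = 0"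
  "comp_y h z k (partial_y i z) = kronecker i k"
  by (auto simp: comp_t_def comp_x_def comp_y_def delta_t_def delta_x_def partial_y_def
      kronecker_def axis_def if_distrib sum.delta sum.delta' cong: if_cong)

lemma sum_kronecker: "(\<Sum>i\<in>UNIV. kronecker j i * f i) = f j"
  by (simp add: kronecker_def if_distrib[where f="\<lambda>a. a * _"] cong: if_cong)

lemma deriv_along_const: "deriv_along X (\<lambda>w. c) z = 0"
  by (simp add: deriv_along_def)

lemma nabla_adapted:
  "nabla h (delta_t h) (delta_t h) z = kappa h (fst z) *\<^sub>R delta_t h z"
  "nabla h (delta_t h) (delta_x h i) z = (\<Sum>k\<in>UNIV. cartan_G h k i z *\<^sub>R delta_x h k z)"
  "nabla h (delta_t h) (partial_y i) z =
     (\<Sum>k\<in>UNIV. (cartan_G h k i z - kappa h (fst z) * kronecker i k) *\<^sub>R partial_y k z)"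
  "nabla h (delta_x h j) (delta_t h) z = 0"
  "nabla h (delta_x h j) (delta_x h i) z = (\<Sum>k\<in>UNIV. cartan_L h k i j z *\<^sub>R delta_x h k z)"
  "nabla h (delta_x h j) (partial_y i) z = (\<Sum>k\<in>UNIV. cartan_L h k i j z *\<^sub>R partial_y k z)"
  "nabla h (partial_y j) (delta_t h) z = 0"
  "nabla h (partial_y j) (delta_x h i) z = (\<Sum>k\<in>UNIV. cartan_C h k i j z *\<^sub>R delta_x h k z)"
  "nabla h (partial_y j) (partial_y i) z = (\<Sum>k\<in>UNIV. cartan_C h k i j z *\<^sub>R partial_y k z)"
  by (simp_all add: nabla_def nabla_t_def nabla_x_def nabla_y_def comp_adapted deriv_along_const
      sum_kronecker)

lemma comp_add_scale:
  "comp_t (u + v) = comp_t u + comp_t v" "comp_t (c *\<^sub>R v) = c * comp_t v"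
  "comp_x k (u + v) = comp_x k u + comp_x k v" "comp_x k (c *\<^sub>R v) = c * comp_x k v"
  "comp_y h z k (u + v) = comp_y h z k u + comp_y h z k v"
  "comp_y h z k (c *\<^sub>R v) = c * comp_y h z k v"
  by (simp_all add: comp_t_def comp_x_def comp_y_def algebra_simps sum.distrib sum_distrib_left)

lemma comp_sum:
  "comp_t (\<Sum>i\<in>A. f i) = (\<Sum>i\<in>A. comp_t (f i))"
  "comp_x k (\<Sum>i\<in>A. f i) = (\<Sum>i\<in>A. comp_x k (f i))"
  "comp_y h z k (\<Sum>i\<in>A. f i) = (\<Sum>i\<in>A. comp_y h z k (f i))"
proof -
  have lin: "linear comp_t" "linear (comp_x k)" "linear (comp_y h z k)"
    by (rule linearI; simp add: comp_add_scale)+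
  show "comp_t (\<Sum>i\<in>A. f i) = (\<Sum>i\<in>A. comp_t (f i))"
    "comp_x k (\<Sum>i\<in>A. f i) = (\<Sum>i\<in>A. comp_x k (f i))"
    "comp_y h z k (\<Sum>i\<in>A. f i) = (\<Sum>i\<in>A. comp_y h z k (f i))"
    using lin by (simp_all add: linear_sum)
qed

lemma comp_nabla:
  "comp_t (nabla h X Y z) = nabla_t h X Y z"
  "comp_x k (nabla h X Y z) = nabla_x h X Y k z"
  "comp_y h z k (nabla h X Y z) = nabla_y h X Y k z"
  by (simp_all add: nabla_def comp_add_scale comp_sum comp_adapted kronecker_def if_distrib
      cong: if_cong)

lemma nabla_leibniz:
  assumes "f differentiable (at z)" "(\<lambda>w. comp_t (Y w)) differentiable (at z)"
    and "\<And>k. (\<lambda>w. comp_x k (Y w)) differentiable (at z)"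
    and "\<And>k. (\<lambda>w. comp_y h w k (Y w)) differentiable (at z)"
  shows "nabla h X (\<lambda>w. f w *\<^sub>R Y w) z = deriv_along X f z *\<^sub>R Y z + f z *\<^sub>R nabla h X Y z"
proof -
  have prod: "deriv_along X (\<lambda>w. f w * u w) z = deriv_along X f z * u z + f z * deriv_along X u z"
    if "u differentiable (at z)" for u :: "jet \<Rightarrow> real"
  proof -
    have "((\<lambda>w. f w * u w) has_derivative
        (\<lambda>v. f z * frechet_derivative u (at z) v + frechet_derivative f (at z) v * u z)) (at z)"
      using assms(1) that by (intro has_derivative_mult) (simp_all add: frechet_derivative_works)
    from frechet_derivative_at[OF this, symmetric] show ?thesis
      by (simp add: deriv_along_def)
  qed
  have "nabla_t h X (\<lambda>w. f w *\<^sub>R Y w) z = deriv_along X f z * comp_t (Y z) + f z * nabla_t h X Y z"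
    by (simp add: nabla_t_def comp_add_scale prod assms algebra_simps)
  moreover have "nabla_x h X (\<lambda>w. f w *\<^sub>R Y w) k z =
      deriv_along X f z * comp_x k (Y z) + f z * nabla_x h X Y k z" for k
    by (simp add: nabla_x_def comp_add_scale prod assms distrib_left sum_distrib_left mult.assoc)
  moreover have "nabla_y h X (\<lambda>w. f w *\<^sub>R Y w) k z =
      deriv_along X f z * comp_y h z k (Y z) + f z * nabla_y h X Y k z" for k
    by (simp add: nabla_y_def comp_add_scale prod assms distrib_left sum_distrib_left mult.assoc)
  ultimately have "nabla h X (\<lambda>w. f w *\<^sub>R Y w) z =
      deriv_along X f z *\<^sub>R (comp_t (Y z) *\<^sub>R delta_t h z
        + (\<Sum>i\<in>UNIV. comp_x i (Y z) *\<^sub>R delta_x h i z)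
        + (\<Sum>i\<in>UNIV. comp_y h z i (Y z) *\<^sub>R partial_y i z))
      + f z *\<^sub>R nabla h X Y z"
    by (simp add: nabla_def scaleR_add_left scaleR_add_right sum.distrib scaleR_sum_right)
  then show ?thesis
    by (simp only: adapted_expansion[symmetric])
qed

lemma nabla_horizontal:
  assumes "\<And>w. comp_t (Y w) = 0" "\<And>w k. comp_y h w k (Y w) = 0"
  shows "comp_t (nabla h X Y z) = 0" "comp_y h z k (nabla h X Y z) = 0"
  by (simp_all add: comp_nabla nabla_t_def nabla_y_def assms deriv_along_const)

lemma curvature_horizontal:
  "curvature h X Y (delta_x h i) z =
     (\<Sum>l\<in>UNIV. comp_x l (curvature h X Y (delta_x h i) z) *\<^sub>R delta_x h l z)"
proof -
  have 1: "comp_t (nabla h W (delta_x h i) w) = 0" "comp_y h w k (nabla h W (delta_x h i) w) = 0"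
    for W w k
    by (rule nabla_horizontal; simp add: comp_adapted)+
  have 2: "comp_t (nabla h V (nabla h W (delta_x h i)) w) = 0"
    "comp_y h w k (nabla h V (nabla h W (delta_x h i)) w) = 0" for V W w k
    by (rule nabla_horizontal; simp add: 1)+
  have "curvature h X Y (delta_x h i) z =
    nabla h X (nabla h Y (delta_x h i)) z + (-1) *\<^sub>R nabla h Y (nabla h X (delta_x h i)) z
      + (-1) *\<^sub>R nabla h (lie_bracket X Y) (delta_x h i) z"
    by (simp add: curvature_def)
  then have "comp_t (curvature h X Y (delta_x h i) z) = 0"
    "\<And>k. comp_y h z k (curvature h X Y (delta_x h i) z) = 0"
    by (simp_all add: comp_add_scale 1 2 del: scaleR_minus_left scaleR_minus1_left)
  then show ?thesis
    using adapted_expansion[of "curvature h X Y (delta_x h i) z" h z] by simp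
qed

end

theory Submission
  imports Defs
begin

text \<open>
  The curvature formulas hold because the Cartan connection is pulled back from the fibre.
  Write \<open>V = sqrt (y\<^sup>1 y\<^sup>2 y\<^sup>3 y\<^sup>4)\<close>. Since \<open>F\<^sup>2 = V / h\<close>, the factor \<open>h\<close> cancels in the metric,
  \<open>g\<^sub>i\<^sub>j = V (1 - 2 \<delta>\<^sub>i\<^sub>j) / (8 y\<^sup>i y\<^sup>j)\<close>, so that the coefficients \<open>G\<close>, \<open>L\<close> and \<open>C\<close> come from
  derivatives in the \<open>y\<close>-directions alone. Two facts about \<open>g\<close> as a function of \<open>y\<close> decide
  their form:

  \<^item> \<open>g\<close> is homogeneous of degree zero, so \<open>G\<^sup>k\<^sub>j\<^sub>1 = 0\<close> and \<open>C\<^sup>l\<^sub>i\<^sub>j y\<^sup>j = 0\<close>;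
  \<^item> \<open>\<partial>g\<^sub>i\<^sub>j / \<partial>y\<^sup>k\<close> is totally symmetric, since \<open>g\<close> is a Hessian, so \<open>L = (\<kappa> / 3) C\<close>.

  Hence, on horizontal fields, the connection form of \<open>\<nabla>\<close> in the frame \<open>\<delta>/\<delta>x\<^sup>i\<close> evaluated on a
  vector \<open>X\<close> is the sum of the products \<open>X\<^sup>j C\<^sup>l\<^sub>i\<^sub>j\<close>, where \<open>X\<^sup>j\<close> are the natural (not the adapted)
  \<open>y\<close>-components of \<open>X\<close>: the terms by which the two kinds of components differ are absorbed by
  \<open>L\<close> and by \<open>C\<^sup>l\<^sub>i\<^sub>j y\<^sup>j = 0\<close> (\<open>nabla_x_eq\<close>). It is therefore the pullback of the Levi-Civita
  connection of \<open>g\<close> along \<open>(t, x, y) \<mapsto> y\<close>, and so is its curvature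
  (\<open>curvature_pullback\<close>): \<open>R(X, Y)\<close> has the components \<open>X\<^sup>k Y\<^sup>j S\<^sup>l\<^sub>i\<^sub>j\<^sub>k\<close>, with \<open>S\<close> the curvature of \<open>C\<close>.

  The natural \<open>y\<close>-components of \<open>\<partial>/\<partial>y\<^sup>i\<close> and \<open>\<delta>/\<delta>x\<^sup>i\<close> are \<open>1\<close> and \<open>\<kappa> / 3\<close> times the \<open>i\<close>-th unit
  vector, which accounts for the factors in \<open>P\<close> and \<open>R\<close>. Those of \<open>\<delta>/\<delta>t\<close> are \<open>\<kappa> y\<close>, and
  \<open>y\<^sup>j S\<^sup>l\<^sub>i\<^sub>j\<^sub>k = 0\<close> by homogeneity (\<open>vertical_curvature_contract\<close>), so the two remaining tensors
  vanish. Finally \<open>S\<close> itself is not zero at \<open>y = (1, 1, 1, 1)\<close>, by direct computation.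
\<close>

section \<open>Natural fibre coordinates and the domain\<close>

abbreviation ycoord :: "4 \<Rightarrow> jet \<Rightarrow> real" where
  "ycoord i z \<equiv> snd (snd z) $ i"

text \<open>
  None of the tensors depends on \<open>x\<close>, so that \<open>U\<close> may be enlarged to all of \<open>\<real>\<^sup>4\<close> in the computations.
\<close>

abbreviation chart_domain :: "jet set" where
  "chart_domain \<equiv> jet_domain UNIV"

lemma chart_domain_iff:
  "z \<in> chart_domain \<longleftrightarrow> 0 < ycoord 1 z * ycoord 2 z * ycoord 3 z * ycoord 4 z"
  by (auto simp: jet_domain_def split: prod.splits)

lemma open_chart_domain: "open chart_domain"
proof -
  have "chart_domain = {z. 0 < ycoord 1 z * ycoord 2 z * ycoord 3 z * ycoord 4 z}"
    using chart_domain_iff by blast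
  moreover have "open {z::jet. 0 < ycoord 1 z * ycoord 2 z * ycoord 3 z * ycoord 4 z}"
    by (intro open_Collect_less continuous_intros)
  ultimately show ?thesis by simp
qed

lemma ycoord_nonzero:
  assumes "z \<in> chart_domain" shows "ycoord i z \<noteq> 0"
  using assms exhaust_4[of i] unfolding chart_domain_iff by auto

section \<open>Derivatives along vector fields\<close>

lemma deriv_along_eqI:
  "(f has_derivative f') (at z) \<Longrightarrow> deriv_along X f z = f' (X z)"
  unfolding deriv_along_def by (metis frechet_derivative_at)

text \<open>
  A Frechet derivative depends on the germ only. Closed formulas valid on the open domain may
  thus be differentiated although nothing is known outside it.
\<close>

lemma deriv_along_cong_open:
  assumes "open S" "z \<in> S" "\<And>w. w \<in> S \<Longrightarrow> f w = g w"
  shows "deriv_along X f z = deriv_along X g z"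
proof -
  have "(f has_derivative f') (at z) \<longleftrightarrow> (g has_derivative f') (at z)" for f'
    using assms has_derivative_transform_within_open[of f f' z UNIV S g]
      has_derivative_transform_within_open[of g f' z UNIV S f] by auto
  then show ?thesis by (simp add: deriv_along_def frechet_derivative_def)
qed

lemma has_derivative_ycoord: "(ycoord i has_derivative ycoord i) (at z)"
  by (intro bounded_linear_imp_has_derivative bounded_linear_compose[OF bounded_linear_vec_nth]
      bounded_linear_compose[OF bounded_linear_snd] bounded_linear_snd)

lemmas has_derivative_ycoord_intro =
  has_derivative_compose[OF _ has_derivative_ycoord]

section \<open>The Berwald-Moor metric\<close>

definition bm_volume :: "jet \<Rightarrow> real" where
  "bm_volume z = sqrt (ycoord 1 z * ycoord 2 z * ycoord 3 z * ycoord 4 z)"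

lemma bm_volume_pos: "z \<in> chart_domain \<Longrightarrow> bm_volume z > 0"
  by (simp add: bm_volume_def chart_domain_iff)

text \<open>
  All functions of \<open>y\<close> below are monomials with exponents in \<open>\<int>/2\<close>. Their derivatives are
  kept in logarithmic form, the function times a combination of the quotients
  \<open>v\<^sup>p / y\<^sup>p\<close>; this makes both homogeneity and symmetry visible.
\<close>

lemma has_derivative_bm_volume:
  assumes "z \<in> chart_domain"
  shows "(bm_volume has_derivative
          (\<lambda>v. bm_volume z / 2 * (\<Sum>p\<in>UNIV. ycoord p v / ycoord p z))) (at z)"
proof -
  let ?P = "\<lambda>z. ycoord 1 z * ycoord 2 z * ycoord 3 z * ycoord 4 z"
  have nz: "ycoord i z \<noteq> 0" for i
    using assms by (rule ycoord_nonzero)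
  have P: "?P z > 0" using assms by (simp add: chart_domain_iff)
  have dP: "(?P has_derivative (\<lambda>v. ?P z * (\<Sum>p\<in>UNIV. ycoord p v / ycoord p z))) (at z)"
    by (rule derivative_eq_intros has_derivative_ycoord refl)+ (simp add: sum_4 fun_eq_iff field_simps nz)
  have "((\<lambda>w. sqrt (?P w)) has_derivative
     (\<lambda>v. ?P z * (\<Sum>p\<in>UNIV. ycoord p v / ycoord p z) * (inverse (sqrt (?P z)) / 2))) (at z)"
    using has_derivative_real_sqrt[OF P dP] by (simp add: mult_ac)
  moreover have "?P z * (\<Sum>p\<in>UNIV. ycoord p v / ycoord p z) * (inverse (sqrt (?P z)) / 2)
     = sqrt (?P z) / 2 * (\<Sum>p\<in>UNIV. ycoord p v / ycoord p z)" for v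
  proof -
    have "?P z * inverse (sqrt (?P z)) = sqrt (?P z)"
      using P by (simp add: real_div_sqrt divide_inverse[symmetric])
    moreover have "a * S * (i / 2) = (a * i) / 2 * S" for a S i :: real by simp
    ultimately show ?thesis by simp
  qed
  ultimately show ?thesis unfolding bm_volume_def by (simp only:)
qed


section \<open>Linear algebra of the constant coefficients\<close>

lemma kronecker_commute: "kronecker i j = kronecker j i"
  by (simp add: kronecker_def)

text \<open>
  The value of \<open>C\<^sup>i\<^sub>j\<^sub>k\<close> at \<open>y = (1, 1, 1, 1)\<close>. It is totally symmetric: \<open>- 3 / 8\<close> if the three
  indices agree, \<open>1 / 8\<close> if exactly two agree, \<open>- 1 / 8\<close> if they are distinct.
\<close>

definition cartan_coeff :: "4 \<Rightarrow> 4 \<Rightarrow> 4 \<Rightarrow> real" where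
  "cartan_coeff i j k =
     (2 * kronecker i j + 2 * kronecker i k + 2 * kronecker j k - 8 * kronecker i j * kronecker j k - 1) / 8"

text \<open>
  The matrix with entries \<open>1 - 2 \<delta>\<^sub>i\<^sub>j\<close> is four times its own inverse; this holds in dimension four
  only.
\<close>

lemma sign_matrix_square:
  "(\<Sum>m\<in>UNIV. (1 - 2 * kronecker i m) * (1 - 2 * kronecker j m)) = 4 * kronecker i j"
  using exhaust_4[of i] exhaust_4[of j] by (auto simp: sum_4 kronecker_def)

section \<open>Coefficients of the Cartan connection\<close>

locale time_metric =
  fixes h :: "real \<Rightarrow> real"
  assumes h_pos: "h t > 0" and h_smooth: "smooth h"
begin

lemma h_nonzero: "h t \<noteq> 0"
  using h_pos[of t] by simp

lemma has_derivative_h: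
  "((\<lambda>w::jet. h (fst w)) has_derivative (\<lambda>v. deriv h (fst z) * fst v)) (at z)"
proof -
  have "(deriv ^^ 0) h differentiable (at t)" for t
    using h_smooth unfolding smooth_def by blast
  then have "(h has_field_derivative deriv h (fst z)) (at (fst z))"
    by (simp add: DERIV_deriv_iff_real_differentiable)
  then have "(h has_derivative (*) (deriv h (fst z))) (at (fst z))"
    by (simp add: has_field_derivative_def)
  from has_derivative_compose[OF has_derivative_fst[OF has_derivative_ident] this]
  show ?thesis by simp
qed

lemma differentiable_kappa: "(\<lambda>w::jet. kappa h (fst w)) differentiable (at z)"
proof -
  have "(deriv ^^ 0) h differentiable (at t)" "(deriv ^^ 1) h differentiable (at t)" for t
    using h_smooth unfolding smooth_def by blast+
  then have "kappa h differentiable (at (fst z))"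
    unfolding kappa_def using h_nonzero[of "fst z"] by (auto intro!: derivative_intros)
  then obtain k' where "(kappa h has_derivative k') (at (fst z))"
    unfolding differentiable_def by blast
  from has_derivative_compose[OF has_derivative_fst[OF has_derivative_ident] this]
  show ?thesis unfolding differentiable_def by blast
qed

lemma berwald_moor_squared:
  assumes "z \<in> chart_domain"
  shows "(berwald_moor h z)\<^sup>2 = bm_volume z / h (fst z)"
proof -
  obtain t x y where z: "z = (t, x, y)" by (cases z) auto
  have P: "0 < y $ 1 * y $ 2 * y $ 3 * y $ 4" (is "0 < ?P")
    using assms by (simp add: z chart_domain_iff)
  have "root 4 ?P = sqrt (sqrt ?P)"
    using real_root_mult_exp[of 2 2 ?P] by (simp add: sqrt_def)
  then have "(root 4 ?P)\<^sup>2 = sqrt ?P" using P by simp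
  moreover have "(sqrt (1 / h t))\<^sup>2 = 1 / h t" using h_pos[of t] by (simp add: less_imp_le)
  ultimately show ?thesis
    by (simp add: z berwald_moor_def bm_volume_def power_mult_distrib)
qed

lemma first_derivative_berwald_moor_squared:
  assumes "z \<in> chart_domain"
  shows "deriv_along (partial_y j) (\<lambda>w. (berwald_moor h w)\<^sup>2) z
       = bm_volume z / (2 * h (fst z) * ycoord j z)"
proof -
  note nz = ycoord_nonzero[OF assms] h_nonzero
  have "deriv_along (partial_y j) (\<lambda>w. (berwald_moor h w)\<^sup>2) z
      = deriv_along (partial_y j) (\<lambda>w. bm_volume w / h (fst w)) z"
    by (intro deriv_along_cong_open[OF open_chart_domain assms] berwald_moor_squared)
  also have "\<dots> = bm_volume z / (2 * h (fst z) * ycoord j z)"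
    by (subst deriv_along_eqI[OF has_derivative_divide[OF has_derivative_bm_volume[OF assms] has_derivative_h]])
      (simp_all add: nz partial_y_def axis_def if_distrib[where f="\<lambda>a. a / _"] field_simps cong: if_cong)
  finally show ?thesis .
qed

lemma metric_g_eq:
  assumes "z \<in> chart_domain"
  shows "metric_g h i j z
       = bm_volume z / 8 * (1 - 2 * kronecker i j) / (ycoord i z * ycoord j z)"
proof -
  note nz = ycoord_nonzero[OF assms] h_nonzero
  have "deriv_along (partial_y i) (deriv_along (partial_y j) (\<lambda>w. (berwald_moor h w)\<^sup>2)) z
      = deriv_along (partial_y i) (\<lambda>w. bm_volume w / (2 * h (fst w) * ycoord j w)) z"
    by (intro deriv_along_cong_open[OF open_chart_domain assms]
        first_derivative_berwald_moor_squared)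
  also have "\<dots> = bm_volume z * (1 - 2 * kronecker i j) / (4 * h (fst z) * ycoord i z * ycoord j z)"
    by (subst deriv_along_eqI[OF has_derivative_divide[OF has_derivative_bm_volume[OF assms]
          has_derivative_mult[OF has_derivative_mult[OF has_derivative_const has_derivative_h]
             has_derivative_ycoord]]])
      (auto simp: nz partial_y_def kronecker_def axis_def if_distrib[where f="\<lambda>a. a / _"]
         field_simps cong: if_cong)
  finally show ?thesis by (simp add: metric_g_def h_nonzero)
qed

lemma has_derivative_metric_g:
  assumes "z \<in> chart_domain"
  shows "(metric_g h i j has_derivative (\<lambda>v. metric_g h i j z *
     ((\<Sum>p\<in>UNIV. ycoord p v / ycoord p z) / 2 - ycoord i v / ycoord i z - ycoord j v / ycoord j z)))
     (at z)"
proof -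
  define c where "c = (1 - 2 * kronecker i j) / 8"
  note nz = ycoord_nonzero[OF assms]
  have c: "metric_g h i j w = c * bm_volume w / (ycoord i w * ycoord j w)" if "w \<in> chart_domain" for w
    using metric_g_eq[OF that, of i j] by (simp add: c_def)
  have "((\<lambda>w. c * bm_volume w / (ycoord i w * ycoord j w)) has_derivative (\<lambda>v. metric_g h i j z *
     ((\<Sum>p\<in>UNIV. ycoord p v / ycoord p z) / 2 - ycoord i v / ycoord i z - ycoord j v / ycoord j z)))
     (at z)"
    by (rule has_derivative_eq_rhs[OF has_derivative_divide[OF
          has_derivative_mult[OF has_derivative_const has_derivative_bm_volume[OF assms]]
          has_derivative_mult[OF has_derivative_ycoord has_derivative_ycoord]]])
      (simp_all add: nz c[OF assms] fun_eq_iff field_simps)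
  from has_derivative_transform_within_open[OF this open_chart_domain assms] show ?thesis
    by (simp add: c)
qed

text \<open>
  Since \<open>g\<close> depends on \<open>y\<close> only, its derivative along \<open>X\<close> sees only the natural
  \<open>y\<close>-components of \<open>X\<close>. For \<open>X = y\<close> the bracket is \<open>4 / 2 - 1 - 1 = 0\<close>.
\<close>

lemma deriv_along_metric_g:
  assumes "z \<in> chart_domain"
  shows "deriv_along X (metric_g h i j) z = metric_g h i j z *
     ((\<Sum>p\<in>UNIV. ycoord p (X z) / ycoord p z) / 2
       - ycoord i (X z) / ycoord i z - ycoord j (X z) / ycoord j z)"
  by (rule deriv_along_eqI[OF has_derivative_metric_g[OF assms]])

lemma vertical_derivative_metric_g:
  assumes "z \<in> chart_domain"
  shows "deriv_along (partial_y k) (metric_g h i j) z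
       = metric_g h i j z * (1 / 2 - kronecker i k - kronecker j k) / ycoord k z"
proof -
  have "ycoord m (partial_y k z) / ycoord m z = kronecker k m * (1 / ycoord k z)" for m
    by (simp add: partial_y_def kronecker_def axis_def)
  then show ?thesis
    unfolding deriv_along_metric_g[OF assms]
    by (simp add: sum_kronecker[where f="\<lambda>_. 1 / ycoord k z", simplified])
       (simp add: kronecker_def field_simps)
qed

lemma ycoord_frame:
  "ycoord j (delta_t h z) = kappa h (fst z) * ycoord j z"
  "ycoord j (delta_x h i z) = kronecker i j * (kappa h (fst z) / 3)"
  "ycoord j (partial_y i z) = kronecker i j"
  by (auto simp: delta_t_def nonlinear_M_def delta_x_def nonlinear_N_def partial_y_def
      kronecker_def axis_def split_beta)

text \<open>
  Up to the factor \<open>V / 8\<close> with \<open>V\<close> the value of \<open>bm_volume\<close>, the metric is the matrix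
  \<open>1 - 2 \<delta>\<^sub>i\<^sub>j\<close> rescaled on both sides by the diagonal matrix of the \<open>1 / y\<^sup>i\<close>, so \<open>sign_matrix_square\<close> supplies the inverse.
\<close>

lemma metric_ginv_eq:
  assumes "z \<in> chart_domain"
  shows "metric_ginv h i j z
       = 2 / bm_volume z * (1 - 2 * kronecker i j) * ycoord i z * ycoord j z"
proof -
  let ?A = "\<chi> a b. metric_g h a b z"
  let ?B = "\<chi> a b. 2 / bm_volume z * (1 - 2 * kronecker a b) * ycoord a z * ycoord b z"
  have nz: "ycoord i z \<noteq> 0" "bm_volume z \<noteq> 0" for i
    using ycoord_nonzero[OF assms] bm_volume_pos[OF assms] by auto
  have "(?A ** ?B) $ a $ b = mat 1 $ a $ b" for a b
  proof -
    have "(?A ** ?B) $ a $ b = (\<Sum>m\<in>UNIV. (1 - 2 * kronecker a m) * (1 - 2 * kronecker b m))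
        * ycoord b z / (4 * ycoord a z)"
      unfolding matrix_matrix_mult_def sum_distrib_right sum_divide_distrib
      by (auto intro!: sum.cong simp: metric_g_eq[OF assms] nz kronecker_def)
    then show ?thesis
      by (simp add: sign_matrix_square) (simp add: mat_def kronecker_def nz)
  qed
  then have "?A ** ?B = mat 1" by (simp add: vec_eq_iff)
  moreover from this have "?B ** ?A = mat 1" by (simp add: matrix_left_right_inverse)
  ultimately have "matrix_inv ?A = ?B"
    unfolding matrix_inv_def
  proof (intro some_equality conjI)
    fix B assume "?A ** B = mat 1 \<and> B ** ?A = mat 1"
    then have "B = B ** (?A ** ?B)" "B ** ?A = mat 1"
      using \<open>?A ** ?B = mat 1\<close> by simp_all
    then show "B = ?B" unfolding matrix_mul_assoc by simp
  qed auto
  then show ?thesis by (simp add: metric_ginv_def)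
qed

lemma cartan_C_eq:
  assumes "z \<in> chart_domain"
  shows "cartan_C h i j k z = cartan_coeff i j k * ycoord i z / (ycoord j z * ycoord k z)"
proof -
  have nz: "ycoord i z \<noteq> 0" "bm_volume z \<noteq> 0" for i
    using ycoord_nonzero[OF assms] bm_volume_pos[OF assms] by auto
  have "cartan_C h i j k z = (\<Sum>m\<in>UNIV. (1 - 2 * kronecker i m) * (1 - 2 * kronecker j m)
         * (1 / 2 - kronecker j k - kronecker m k)) / 8 * ycoord i z / (ycoord j z * ycoord k z)"
    unfolding cartan_C_def sum_distrib_right sum_divide_distrib
    by (intro sum.cong refl)
      (simp add: metric_ginv_eq[OF assms] vertical_derivative_metric_g[OF assms] metric_g_eq[OF assms] nz field_simps)
  also have "(\<Sum>m\<in>UNIV. (1 - 2 * kronecker i m) * (1 - 2 * kronecker j m)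
         * (1 / 2 - kronecker j k - kronecker m k)) / 8 = cartan_coeff i j k"
    using exhaust_4[of i] exhaust_4[of j] exhaust_4[of k]
    by (auto simp: sum_4 kronecker_def cartan_coeff_def)
  finally show ?thesis .
qed

text \<open>
  Euler's relation: \<open>C\<^sup>l\<^sub>i\<^sub>j y\<^sup>j\<close> is half the radial derivative of a metric that is homogeneous of
  degree zero, with one index raised.
\<close>

lemma cartan_C_contract:
  assumes "z \<in> chart_domain"
  shows "(\<Sum>j\<in>UNIV. cartan_C h l i j z * ycoord j z) = 0"
proof -
  note nz = ycoord_nonzero[OF assms]
  have "(\<Sum>j\<in>UNIV. cartan_C h l i j z * ycoord j z)
      = (\<Sum>j\<in>UNIV. cartan_coeff l i j) * ycoord l z / ycoord i z"
    unfolding sum_distrib_right sum_divide_distrib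
    by (intro sum.cong refl) (simp add: cartan_C_eq[OF assms] nz)
  also have "(\<Sum>j\<in>UNIV. cartan_coeff l i j) = 0"
    using exhaust_4[of i] exhaust_4[of l] by (auto simp: sum_4 kronecker_def cartan_coeff_def)
  finally show ?thesis by simp
qed

text \<open>
  On functions of \<open>y\<close> the operator \<open>\<delta>/\<delta>x\<^sup>k\<close> is \<open>\<kappa> / 3\<close> times \<open>\<partial>/\<partial>y\<^sup>k\<close>. The three terms in \<open>L\<close> are then
  equal by the total symmetry of \<open>\<partial>g\<^sub>j\<^sub>m / \<partial>y\<^sup>k\<close>, and two of them cancel.
\<close>

lemma cartan_L_eq:
  assumes "z \<in> chart_domain"
  shows "cartan_L h i j k z = kappa h (fst z) / 3 * cartan_C h i j k z"
proof -
  have dx: "ycoord m (delta_x h k z) = kappa h (fst z) / 3 * ycoord m (partial_y k z)" for m k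
    by (simp add: ycoord_frame)
  have d: "deriv_along (delta_x h k) (metric_g h j m) z
      = kappa h (fst z) / 3 * deriv_along (partial_y k) (metric_g h j m) z" for j k m
  proof -
    \<comment> \<open>The logarithmic derivative is linear in the direction, so the factor \<open>\<kappa> / 3\<close> comes out.\<close>
    have lin: "g * (c * S / 2 - c * a / p - c * b / q) = c * (g * (S / 2 - a / p - b / q))"
      for g c S a b p q :: real by (simp add: algebra_simps)
    have "(\<Sum>p\<in>UNIV. ycoord p (delta_x h k z) / ycoord p z)
        = kappa h (fst z) / 3 * (\<Sum>p\<in>UNIV. ycoord p (partial_y k z) / ycoord p z)"
      unfolding dx sum_distrib_left by simp
    then show ?thesis
      unfolding deriv_along_metric_g[OF assms] by (simp only: dx lin)
  qed
  have sym: "deriv_along (partial_y k) (metric_g h j m) z = deriv_along (partial_y m) (metric_g h j k) z"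
    for j k m
    by (auto simp: vertical_derivative_metric_g[OF assms] metric_g_eq[OF assms] kronecker_def)
  have "deriv_along (partial_y j) (metric_g h k m) z = deriv_along (partial_y m) (metric_g h j k) z"
    for m
    by (auto simp: vertical_derivative_metric_g[OF assms] metric_g_eq[OF assms] kronecker_def)
  then show ?thesis
    unfolding cartan_L_def cartan_C_def d sum_distrib_left
    by (intro sum.cong refl) (simp add: sym[of k j])
qed

lemma cartan_G_eq:
  assumes "z \<in> chart_domain"
  shows "cartan_G h k j z = 0"
proof -
  show ?thesis
    unfolding cartan_G_def deriv_along_metric_g[OF assms] ycoord_frame
    using ycoord_nonzero[OF assms] by (simp add: sum_4)
qed

section \<open>The connection and its curvature as pullbacks\<close>

text \<open>
  The adapted component \<open>comp_y\<close> differs from the natural one by \<open>\<kappa>\<close> times the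
  \<open>t\<close>-component times \<open>y\<^sup>j\<close>, which \<open>C\<close> annihilates, and by \<open>\<kappa> / 3\<close> times the \<open>x\<close>-component, which is
  exactly the contribution of \<open>L = (\<kappa> / 3) C\<close>.
\<close>

lemma nabla_x_eq:
  assumes "z \<in> chart_domain"
  shows "nabla_x h X V l z = deriv_along X (\<lambda>w. comp_x l (V w)) z
       + (\<Sum>m\<in>UNIV. comp_x m (V z) * (\<Sum>j\<in>UNIV. ycoord j (X z) * cartan_C h l m j z))"
proof -
  have y: "comp_y h z j v = ycoord j v - kappa h (fst z) * fst v * ycoord j z
      - kappa h (fst z) / 3 * comp_x j v" for j v
  proof -
    have "(\<Sum>i\<in>UNIV. nonlinear_N h j i z * comp_x i v)
        = (\<Sum>i\<in>UNIV. kronecker j i * (- kappa h (fst z) / 3 * comp_x i v))"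
      by (simp add: nonlinear_N_def split_beta mult_ac)
    also have "\<dots> = - kappa h (fst z) / 3 * comp_x j v"
      by (rule sum_kronecker)
    finally show ?thesis
      unfolding comp_y_def comp_x_def[symmetric] by (simp add: nonlinear_M_def split_beta)
  qed
  have "(\<Sum>j\<in>UNIV. comp_x j v * cartan_L h l m j z) + (\<Sum>j\<in>UNIV. comp_y h z j v * cartan_C h l m j z)
      = (\<Sum>j\<in>UNIV. ycoord j v * cartan_C h l m j z)" for m v
  proof -
    have "(\<Sum>j\<in>UNIV. comp_x j v * cartan_L h l m j z) + (\<Sum>j\<in>UNIV. comp_y h z j v * cartan_C h l m j z)
      = (\<Sum>j\<in>UNIV. ycoord j v * cartan_C h l m j z)
        - kappa h (fst z) * fst v * (\<Sum>j\<in>UNIV. cartan_C h l m j z * ycoord j z)"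
      unfolding y cartan_L_eq[OF assms] sum_distrib_left sum.distrib[symmetric] sum_subtractf[symmetric]
      by (intro sum.cong refl) (simp add: algebra_simps)
    then show ?thesis by (simp add: cartan_C_contract[OF assms])
  qed
  then show ?thesis
    unfolding nabla_x_def cartan_G_eq[OF assms] by simp
qed

lemma has_derivative_cartan_C:
  assumes "z \<in> chart_domain"
  shows "(cartan_C h l i j has_derivative (\<lambda>v. cartan_C h l i j z *
     (ycoord l v / ycoord l z - ycoord i v / ycoord i z - ycoord j v / ycoord j z))) (at z)"
proof -
  note nz = ycoord_nonzero[OF assms]
  have "((\<lambda>w. cartan_coeff l i j * ycoord l w / (ycoord i w * ycoord j w)) has_derivative
    (\<lambda>v. cartan_C h l i j z *
       (ycoord l v / ycoord l z - ycoord i v / ycoord i z - ycoord j v / ycoord j z))) (at z)"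
    by (rule has_derivative_eq_rhs[OF has_derivative_divide[OF
          has_derivative_mult[OF has_derivative_const has_derivative_ycoord]
          has_derivative_mult[OF has_derivative_ycoord has_derivative_ycoord]]])
      (simp_all add: nz cartan_C_eq[OF assms] fun_eq_iff field_simps)
  from has_derivative_transform_within_open[OF this open_chart_domain assms] show ?thesis
    by (simp add: cartan_C_eq)
qed

lemma vertical_derivative_cartan_C:
  assumes "z \<in> chart_domain"
  shows "deriv_along (partial_y k) (cartan_C h l i j) z
       = cartan_C h l i j z * (kronecker l k - kronecker i k - kronecker j k) / ycoord k z"
  unfolding deriv_along_eqI[OF has_derivative_cartan_C[OF assms]]
  by (simp add: partial_y_def kronecker_def axis_def field_simps)

lemma deriv_along_cartan_C:
  assumes "z \<in> chart_domain"
  shows "deriv_along X (cartan_C h l i j) z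
       = (\<Sum>k\<in>UNIV. ycoord k (X z) * deriv_along (partial_y k) (cartan_C h l i j) z)"
proof -
  have "(\<Sum>k\<in>UNIV. ycoord k (X z) * deriv_along (partial_y k) (cartan_C h l i j) z)
      = cartan_C h l i j z * ((\<Sum>k\<in>UNIV. kronecker l k * (ycoord k (X z) / ycoord k z))
        - (\<Sum>k\<in>UNIV. kronecker i k * (ycoord k (X z) / ycoord k z))
        - (\<Sum>k\<in>UNIV. kronecker j k * (ycoord k (X z) / ycoord k z)))"
    unfolding vertical_derivative_cartan_C[OF assms] sum_distrib_left sum_subtractf[symmetric]
    by (intro sum.cong refl) (simp add: algebra_simps diff_divide_distrib add_divide_distrib)
  then show ?thesis
    unfolding deriv_along_eqI[OF has_derivative_cartan_C[OF assms]] sum_kronecker by simp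
qed

text \<open>
  The curvature of the Levi-Civita connection of \<open>g\<close> on a single fibre, with \<open>l\<close> the upper index.
\<close>

definition vertical_curvature :: "4 \<Rightarrow> 4 \<Rightarrow> 4 \<Rightarrow> 4 \<Rightarrow> jet \<Rightarrow> real" where
  "vertical_curvature l i j k z =
     deriv_along (partial_y k) (cartan_C h l i j) z
     - deriv_along (partial_y j) (cartan_C h l i k) z
     + (\<Sum>m\<in>UNIV. cartan_C h m i j z * cartan_C h l m k z)
     - (\<Sum>m\<in>UNIV. cartan_C h m i k z * cartan_C h l m j z)"

text \<open>
  One half of the curvature, prepared for antisymmetrization in \<open>X\<close> and \<open>Y\<close>: the first sum
  is the part with derivatives of \<open>Y\<close>, which the Lie bracket will cancel; the second is tensorial.
\<close>

lemma nabla_nabla_delta_x: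
  assumes z: "z \<in> chart_domain" and Y: "Y differentiable (at z)"
  shows "comp_x l (nabla h X (nabla h Y (delta_x h i)) z)
       = (\<Sum>j\<in>UNIV. ycoord j (deriv_along X Y z) * cartan_C h l i j z)
         + (\<Sum>k\<in>UNIV. \<Sum>j\<in>UNIV. ycoord k (X z) * ycoord j (Y z) *
              (deriv_along (partial_y k) (cartan_C h l i j) z
               + (\<Sum>m\<in>UNIV. cartan_C h m i j z * cartan_C h l m k z)))"
proof -
  let ?C = "cartan_C h"
  have first: "comp_x m (nabla h Y (delta_x h i) w) = (\<Sum>j\<in>UNIV. ycoord j (Y w) * ?C m i j w)"
    if "w \<in> chart_domain" for m w
    by (simp add: comp_nabla nabla_x_eq[OF that] comp_adapted deriv_along_const sum_kronecker)
  have dY: "(Y has_derivative frechet_derivative Y (at z)) (at z)"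
    using Y by (simp add: frechet_derivative_works)
  have "deriv_along X (\<lambda>w. comp_x l (nabla h Y (delta_x h i) w)) z
      = deriv_along X (\<lambda>w. \<Sum>j\<in>UNIV. ycoord j (Y w) * ?C l i j w) z"
    by (intro deriv_along_cong_open[OF open_chart_domain z] first)
  also have "\<dots> = (\<Sum>j\<in>UNIV. ycoord j (Y z) * deriv_along X (?C l i j) z
        + ycoord j (deriv_along X Y z) * ?C l i j z)"
    unfolding deriv_along_eqI[OF has_derivative_cartan_C[OF z]]
    by (rule trans[OF deriv_along_eqI[OF has_derivative_sum[OF has_derivative_mult[OF
          has_derivative_ycoord_intro[OF dY] has_derivative_cartan_C[OF z]]]]])
       (simp add: deriv_along_def)
  also have "\<dots> = (\<Sum>j\<in>UNIV. ycoord j (deriv_along X Y z) * ?C l i j z)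
      + (\<Sum>k\<in>UNIV. \<Sum>j\<in>UNIV. ycoord k (X z) * ycoord j (Y z) * deriv_along (partial_y k) (?C l i j) z)"
    unfolding deriv_along_cartan_C[OF z, of X] sum.distrib sum_distrib_left
    by (subst sum.swap) (simp add: mult_ac)
  finally have diff: "deriv_along X (\<lambda>w. comp_x l (nabla h Y (delta_x h i) w)) z = \<dots>" .
  have "(\<Sum>m\<in>UNIV. (\<Sum>j\<in>UNIV. ycoord j (Y z) * ?C m i j z) * (\<Sum>k\<in>UNIV. ycoord k (X z) * ?C l m k z))
      = (\<Sum>m\<in>UNIV. \<Sum>k\<in>UNIV. \<Sum>j\<in>UNIV. ycoord k (X z) * ycoord j (Y z) * (?C m i j z * ?C l m k z))"
    unfolding sum_product by (rule sum.cong[OF refl], subst sum.swap) (simp add: mult_ac)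
  also have "\<dots> = (\<Sum>k\<in>UNIV. \<Sum>m\<in>UNIV. \<Sum>j\<in>UNIV. ycoord k (X z) * ycoord j (Y z) * (?C m i j z * ?C l m k z))"
    by (rule sum.swap)
  also have "\<dots> = (\<Sum>k\<in>UNIV. \<Sum>j\<in>UNIV. ycoord k (X z) * ycoord j (Y z) * (\<Sum>m\<in>UNIV. ?C m i j z * ?C l m k z))"
    unfolding sum_distrib_left by (rule sum.cong[OF refl], rule sum.swap)
  finally show ?thesis
    unfolding comp_nabla(2)[of l h X "nabla h Y (delta_x h i)"]
      nabla_x_eq[OF z, of X "nabla h Y (delta_x h i)"] diff first[OF z]
    by (simp add: distrib_left sum.distrib)
qed

text \<open>
  The natural basis commutes, so the natural \<open>y\<close>-components of the bracket are just the
  differences of derivatives of components, and no curvature of the nonlinear connection enters.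
\<close>

lemma curvature_pullback:
  assumes z: "z \<in> chart_domain" and X: "X differentiable (at z)" and Y: "Y differentiable (at z)"
  shows "comp_x l (curvature h X Y (delta_x h i) z)
       = (\<Sum>k\<in>UNIV. \<Sum>j\<in>UNIV. ycoord k (X z) * ycoord j (Y z) * vertical_curvature l i j k z)"
proof -
  let ?C = "cartan_C h"
  have comp_diff: "comp_x l (u - v) = comp_x l u - comp_x l v" for u v
    by (simp add: comp_x_def)
  have bracket: "comp_x l (nabla h (lie_bracket X Y) (delta_x h i) z)
      = (\<Sum>j\<in>UNIV. ycoord j (deriv_along X Y z) * ?C l i j z)
        - (\<Sum>j\<in>UNIV. ycoord j (deriv_along Y X z) * ?C l i j z)"
    by (simp add: comp_nabla nabla_x_eq[OF z] comp_adapted deriv_along_const sum_kronecker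
        lie_bracket_def left_diff_distrib sum_subtractf)
  have swapped: "(\<Sum>k\<in>UNIV. \<Sum>j\<in>UNIV. ycoord k (Y z) * ycoord j (X z) *
        (deriv_along (partial_y k) (?C l i j) z + (\<Sum>m\<in>UNIV. ?C m i j z * ?C l m k z)))
      = (\<Sum>k\<in>UNIV. \<Sum>j\<in>UNIV. ycoord k (X z) * ycoord j (Y z) *
        (deriv_along (partial_y j) (?C l i k) z + (\<Sum>m\<in>UNIV. ?C m i k z * ?C l m j z)))"
    by (subst sum.swap) (simp add: mult_ac)
  have "(\<Sum>k\<in>UNIV. \<Sum>j\<in>UNIV. ycoord k (X z) * ycoord j (Y z) * vertical_curvature l i j k z)
      = (\<Sum>k\<in>UNIV. \<Sum>j\<in>UNIV. ycoord k (X z) * ycoord j (Y z) *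
          (deriv_along (partial_y k) (?C l i j) z + (\<Sum>m\<in>UNIV. ?C m i j z * ?C l m k z)))
        - (\<Sum>k\<in>UNIV. \<Sum>j\<in>UNIV. ycoord k (X z) * ycoord j (Y z) *
          (deriv_along (partial_y j) (?C l i k) z + (\<Sum>m\<in>UNIV. ?C m i k z * ?C l m j z)))"
    unfolding sum_subtractf[symmetric] right_diff_distrib[symmetric] vertical_curvature_def
    by (simp add: algebra_simps)
  then show ?thesis
    unfolding curvature_def comp_diff nabla_nabla_delta_x[OF z X] nabla_nabla_delta_x[OF z Y]
      bracket swapped by simp
qed

text \<open>
  \<open>C\<close> is homogeneous of degree \<open>- 1\<close> and annihilates \<open>y\<close>. Differentiating \<open>y\<^sup>j C\<^sup>l\<^sub>i\<^sub>j = 0\<close> by \<open>y\<^sup>k\<close> gives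
  \<open>- C\<^sup>l\<^sub>i\<^sub>k\<close> for the first term (\<open>d1\<close>), and Euler's relation gives the same for the second (\<open>d2\<close>);
  the quadratic terms vanish separately.
\<close>

lemma vertical_curvature_contract:
  assumes "z \<in> chart_domain"
  shows "(\<Sum>j\<in>UNIV. ycoord j z * vertical_curvature l i j k z) = 0"
proof -
  let ?C = "cartan_C h"
  note nz = ycoord_nonzero[OF assms]
  have C: "(\<Sum>j\<in>UNIV. ycoord j z * ?C a b j z) = 0" for a b
    using cartan_C_contract[OF assms, of a b] by (simp add: mult.commute)
  have "(\<Sum>j\<in>UNIV. ycoord j z * deriv_along (partial_y k) (?C l i j) z)
      = (kronecker l k - kronecker i k) / ycoord k z * (\<Sum>j\<in>UNIV. ycoord j z * ?C l i j z)
        - (\<Sum>j\<in>UNIV. kronecker k j * (ycoord j z * ?C l i j z / ycoord k z))"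
    unfolding vertical_derivative_cartan_C[OF assms] sum_distrib_left sum_subtractf[symmetric]
    by (intro sum.cong refl)
      (simp add: kronecker_commute[of k] algebra_simps diff_divide_distrib add_divide_distrib)
  then have d1: "(\<Sum>j\<in>UNIV. ycoord j z * deriv_along (partial_y k) (?C l i j) z) = - ?C l i k z"
    unfolding C sum_kronecker by (simp add: nz)
  have d2: "(\<Sum>j\<in>UNIV. ycoord j z * deriv_along (partial_y j) (?C l i k) z) = - ?C l i k z"
    using deriv_along_cartan_C[OF assms, of "\<lambda>w. w" l i k]
    by (simp add: deriv_along_eqI[OF has_derivative_cartan_C[OF assms]] nz)
  have q1: "(\<Sum>j\<in>UNIV. ycoord j z * (\<Sum>m\<in>UNIV. ?C m i j z * ?C l m k z)) = 0"
  proof -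
    have "(\<Sum>j\<in>UNIV. ycoord j z * (\<Sum>m\<in>UNIV. ?C m i j z * ?C l m k z))
        = (\<Sum>m\<in>UNIV. (\<Sum>j\<in>UNIV. ycoord j z * ?C m i j z) * ?C l m k z)"
      unfolding sum_distrib_left sum_distrib_right by (subst sum.swap) (simp add: mult_ac)
    then show ?thesis by (simp add: C)
  qed
  have q2: "(\<Sum>j\<in>UNIV. ycoord j z * (\<Sum>m\<in>UNIV. ?C m i k z * ?C l m j z)) = 0"
  proof -
    have "(\<Sum>j\<in>UNIV. ycoord j z * (\<Sum>m\<in>UNIV. ?C m i k z * ?C l m j z))
        = (\<Sum>m\<in>UNIV. ?C m i k z * (\<Sum>j\<in>UNIV. ycoord j z * ?C l m j z))"
      unfolding sum_distrib_left by (subst sum.swap) (simp add: mult_ac)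
    then show ?thesis by (simp add: C)
  qed
  show ?thesis
    unfolding vertical_curvature_def distrib_left right_diff_distrib sum.distrib sum_subtractf d1 d2 q1 q2
    by simp
qed

text \<open>
  At this point the derivative terms contribute \<open>- 1 / 8 - 1 / 8\<close> and the quadratic
  ones \<open>1 / 16 + 1 / 16\<close>.
\<close>

lemma vertical_curvature_at_ones:
  assumes "\<And>i. ycoord i z = 1"
  shows "vertical_curvature 1 2 1 2 z = - 1 / 8"
proof -
  have z: "z \<in> chart_domain" by (simp add: chart_domain_iff assms)
  show ?thesis
    unfolding vertical_curvature_def vertical_derivative_cartan_C[OF z]
    by (simp add: cartan_C_eq[OF z] assms cartan_coeff_def kronecker_def sum_4)
qed

section \<open>The five curvature d-tensors\<close>

lemma frame_differentiable:
  "delta_t h differentiable (at z)" "delta_x h i differentiable (at z)" "partial_y i differentiable (at z)"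
proof -
  have y: "(\<lambda>w::jet. snd (snd w)) differentiable (at z)"
    by (intro bounded_linear_imp_differentiable bounded_linear_compose[OF bounded_linear_snd] bounded_linear_snd)
  have k: "(\<lambda>w::jet. kappa h (fst w) / 3) differentiable (at z)"
    using differentiable_cmult_left_iff[of "1 / 3 :: real" "\<lambda>w::jet. kappa h (fst w)" z]
      differentiable_kappa by simp
  have "delta_t h = (\<lambda>w. (1, 0, kappa h (fst w) *\<^sub>R snd (snd w)))"
    by (auto simp: fun_eq_iff delta_t_def nonlinear_M_def vec_eq_iff)
  then show "delta_t h differentiable (at z)"
    using differentiable_Pair[OF differentiable_const differentiable_Pair[OF differentiable_const
      differentiable_scaleR[OF differentiable_kappa y]]] by simp
  have "delta_x h i = (\<lambda>w. (0, axis i 1, (kappa h (fst w) / 3) *\<^sub>R axis i 1))"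
    by (auto simp: fun_eq_iff delta_x_def nonlinear_N_def vec_eq_iff kronecker_def axis_def)
  then show "delta_x h i differentiable (at z)"
    using differentiable_Pair[OF differentiable_const differentiable_Pair[OF differentiable_const
      differentiable_scaleR[OF k differentiable_const]]] by simp
  have "partial_y i = (\<lambda>w. (0, 0, axis i 1))"
    by (auto simp: partial_y_def)
  then show "partial_y i differentiable (at z)"
    by simp
qed

lemma curvature_components:
  assumes "z \<in> chart_domain"
  shows "curv_S h l i j k z = vertical_curvature l i j k z"
    and "curv_P h l i j k z = kappa h (fst z) / 3 * vertical_curvature l i j k z"
    and "curv_R h l i j k z = kappa h (fst z) / 3 * (kappa h (fst z) / 3) * vertical_curvature l i j k z"
    and "curv_P1 h l i k z = 0"
    and "curv_R1 h l i k z = 0"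
proof -
  note pullback = curvature_pullback[OF assms frame_differentiable(3) frame_differentiable(3)]
    curvature_pullback[OF assms frame_differentiable(3) frame_differentiable(2)]
    curvature_pullback[OF assms frame_differentiable(2) frame_differentiable(2)]
    curvature_pullback[OF assms frame_differentiable(3) frame_differentiable(1)]
    curvature_pullback[OF assms frame_differentiable(2) frame_differentiable(1)]
  show "curv_S h l i j k z = vertical_curvature l i j k z"
    "curv_P h l i j k z = kappa h (fst z) / 3 * vertical_curvature l i j k z"
    "curv_R h l i j k z = kappa h (fst z) / 3 * (kappa h (fst z) / 3) * vertical_curvature l i j k z"
    unfolding curv_S_def curv_P_def curv_R_def pullback ycoord_frame
    by (simp_all only: mult.assoc sum_distrib_left[symmetric] sum_kronecker)
  show "curv_P1 h l i k z = 0" "curv_R1 h l i k z = 0"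
    unfolding curv_P1_def curv_R1_def pullback ycoord_frame
    by (simp_all only: mult.assoc sum_distrib_left[symmetric] sum_kronecker
        vertical_curvature_contract[OF assms])
qed

end

theorem theorem4p5:
  fixes h :: "real \<Rightarrow> real" and U :: "(real^4) set"
  assumes "\<forall>t. h t > 0" and "smooth h" and "open U" and "U \<noteq> {}"
  shows
    "(\<forall>z \<in> jet_domain U. \<forall>l i j k.
        curv_R h l i j k z = 1 / 9 * kappa h (fst z) * kappa h (fst z) * curv_S h l i j k z \<and>
        curv_P h l i j k z = 1 / 3 * kappa h (fst z) * curv_S h l i j k z \<and>
        curv_S h l i j k z =
          deriv_along (partial_y k) (cartan_C h l i j) z
          - deriv_along (partial_y j) (cartan_C h l i k) z
          + (\<Sum>m\<in>UNIV. cartan_C h m i j z * cartan_C h l m k z)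
          - (\<Sum>m\<in>UNIV. cartan_C h m i k z * cartan_C h l m j z) \<and>
        curv_R1 h l i k z = 0 \<and>
        curv_P1 h l i k z = 0) \<and>
     (\<exists>z \<in> jet_domain U. \<exists>l i j k. curv_S h l i j k z \<noteq> 0) \<and>
     ((\<exists>t. kappa h t \<noteq> 0) \<longrightarrow>
        (\<exists>z \<in> jet_domain U. \<exists>l i j k. curv_R h l i j k z \<noteq> 0) \<and>
        (\<exists>z \<in> jet_domain U. \<exists>l i j k. curv_P h l i j k z \<noteq> 0))"
proof -
  interpret time_metric h
    using assms(1,2) by unfold_locales auto
  obtain x where x: "x \<in> U" using assms(4) by blast
  have inside: "z \<in> chart_domain" if "z \<in> jet_domain U" for z
    using that by (auto simp: jet_domain_def)
  define e :: "real \<Rightarrow> jet" where "e t = (t, x, \<chi> i. 1)" for t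
  have e: "e t \<in> jet_domain U" for t
    by (simp add: e_def jet_domain_def x)
  have S: "vertical_curvature 1 2 1 2 (e t) \<noteq> 0" for t
    using vertical_curvature_at_ones[of "e t"] by (simp add: e_def)
  have "curv_S h 1 2 1 2 (e t) \<noteq> 0" for t
    using S by (simp add: curvature_components[OF inside[OF e]])
  moreover have "curv_R h 1 2 1 2 (e t) \<noteq> 0" "curv_P h 1 2 1 2 (e t) \<noteq> 0" if "kappa h t \<noteq> 0" for t
    using S that by (simp_all add: curvature_components[OF inside[OF e]]) (simp_all add: e_def)
  moreover have "\<forall>z \<in> jet_domain U. \<forall>l i j k.
        curv_R h l i j k z = 1 / 9 * kappa h (fst z) * kappa h (fst z) * curv_S h l i j k z \<and>
        curv_P h l i j k z = 1 / 3 * kappa h (fst z) * curv_S h l i j k z \<and>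
        curv_S h l i j k z =
          deriv_along (partial_y k) (cartan_C h l i j) z
          - deriv_along (partial_y j) (cartan_C h l i k) z
          + (\<Sum>m\<in>UNIV. cartan_C h m i j z * cartan_C h l m k z)
          - (\<Sum>m\<in>UNIV. cartan_C h m i k z * cartan_C h l m j z) \<and>
        curv_R1 h l i k z = 0 \<and>
        curv_P1 h l i k z = 0"
    using curvature_components[OF inside] by (simp add: vertical_curvature_def)
  ultimately show ?thesis
    using e by blast
qed

end
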